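(* Let $\mu_0=\sum_{i=1}^Nc_0^i\sigma^i\delta_{w_0^i}$ be such that $y_0=K\mu_0$, with $c_0^i>0$, $\sigma^i\in\{-1,1\}$ and $w_0^i\in\overline{R}_{\pi^i}\cap\mathbb{S}^{d-1}$, $\pi^i\in\{0,1\}^n$, for all $i=1,\dots,N$. Let $\eta_0$ be a dual certificate for $\mu_0$, and suppose that the vectors $\{K\delta_{w_0^i}\}_{i=1}^N$ are linearly independent and that $$|\eta_0(w)|<1\quad\text{for all }w\in\mathbb{S}^{d-1}\setminus\{w_0^1,\dots,w_0^N\}.$$ Then $\mu_0$ is the unique solution of the interpolation problem $(P_0)$.
   Context: Setting. $d,n$ are positive integers, $x^1,\dots,x^n\in\mathbb{R}^d\setminus\{0\}$ are given data points, $y_0\in\mathbb{R}^n$, and $\sigma(z)=\max\{0,z\}$ is the ReLU function (the $\sigma^i$ are signs). $M(\mathbb{S}^{d-1})$ is the space of finite signed Radon measures on the unit sphere $\mathbb{S}^{d-1}\subset\mathbb{R}^d$, with total variation norm $\|\cdot\|_{\mathrm{TV}}$. $K:M(\mathbb{S}^{d-1})\to\mathbb{R}^n$ is $(K\mu)_j=\int_{\mathbb{S}^{d-1}}\sigma(\langle w,x^j\rangle)\,d\mu(w)$, and $K_*:\mathbb{R}^n\to C(\mathbb{S}^{d-1})$ is $K_*p(w)=\sum_{j=1}^np^j\sigma(\langle w,x^j\rangle)$. Interpolation problem $(P_0)$: minimize $\|\mu\|_{\mathrm{TV}}$ over $\mu\in M(\mathbb{S}^{d-1})$ with $K\mu=y_0$.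 Dual certificate: $\eta_0\in C(\mathbb{S}^{d-1})$ is a dual certificate for $\mu_0$ (where $K\mu_0=y_0$) if $\eta_0=K_*p_0$ for some $p_0\in\mathbb{R}^n$ and $\eta_0\in\partial\|\mu_0\|_{\mathrm{TV}}$, i.e. $\|\eta_0\|_\infty\le1$ and $\int\eta_0\,d\mu_0=\|\mu_0\|_{\mathrm{TV}}$. For $\pi\in\{0,1\}^n$, $R_\pi$ is the open set of $w\in\mathbb{R}^d$ such that for every $j$, $\langle w,x^j\rangle>0$ if $\pi_j=1$ and $\langle w,x^j\rangle<0$ if $\pi_j=0$; $\overline R_\pi$ is its closure. *)

theory Defs
  imports "HOL-Analysis.Analysis"
begin

definition sphere_borel :: "'a::euclidean_space set set" where
  "sphere_borel = sets (restrict_space borel (sphere 0 1))"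

definition signed_measure :: "('a::euclidean_space set \<Rightarrow> real) \<Rightarrow> bool" where
  "signed_measure m \<longleftrightarrow>
     (\<forall>A :: nat \<Rightarrow> 'a set. range A \<subseteq> sphere_borel \<and> disjoint_family A \<longrightarrow>
        (\<lambda>i. m (A i)) sums m (\<Union>i. A i))"

text \<open>Inner regularity of the variation, stated without mentioning the variation: the supremum
  of \<open>\<bar>m B\<bar>\<close> over the Borel sets \<open>B \<subseteq> E\<close> lies between half the variation of \<open>m\<close> on \<open>E\<close> and that
  variation.\<close>

definition regular_set_function :: "('a::euclidean_space set \<Rightarrow> real) \<Rightarrow> bool" where
  "regular_set_function m \<longleftrightarrow>
     (\<forall>A\<in>sphere_borel. \<forall>e>0. \<exists>C. compact C \<and> C \<subseteq> A \<and>
        (\<forall>B\<in>sphere_borel. B \<subseteq> A - C \<longrightarrow> \<bar>m B\<bar> < e))"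

text \<open>The values off the Borel sets are fixed to \<open>0\<close>, so that equality in the type below is equality
  of measures.\<close>

typedef (overloaded) ('a::euclidean_space) sphere_measure =
  "{m :: 'a set \<Rightarrow> real. signed_measure m \<and> regular_set_function m \<and> (\<forall>A. A \<notin> sphere_borel \<longrightarrow> m A = 0)}"
  morphisms mass Abs_sphere_measure
  by (rule exI[of _ "\<lambda>_. 0"]) (auto simp: signed_measure_def regular_set_function_def intro!: exI[of _ "{}"])

setup_lifting type_definition_sphere_measure

lemma signed_measure_scale: "signed_measure m \<Longrightarrow> signed_measure (\<lambda>A. c * m A)"
  unfolding signed_measure_def by (intro allI impI sums_mult) simp

lemma signed_measure_add: "signed_measure m \<Longrightarrow> signed_measure n \<Longrightarrow> signed_measure (\<lambda>A. m A + n A)"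
  unfolding signed_measure_def by (intro allI impI sums_add) simp_all

lemma regular_scale:
  assumes "regular_set_function m"
  shows "regular_set_function (\<lambda>A. c * m A)"
  unfolding regular_set_function_def
proof (intro ballI allI impI)
  fix A :: "'a set" and e :: real
  assume A: "A \<in> sphere_borel" and e: "0 < e"
  define d where "d = e / (\<bar>c\<bar> + 1)"
  have d: "d > 0" using e by (simp add: d_def add_nonneg_pos)
  then obtain C where C: "compact C" "C \<subseteq> A"
    and less: "\<forall>B\<in>sphere_borel. B \<subseteq> A - C \<longrightarrow> \<bar>m B\<bar> < d"
    using assms A unfolding regular_set_function_def by meson
  have "\<bar>c * m B\<bar> < e" if "B \<in> sphere_borel" "B \<subseteq> A - C" for B
  proof -
    have "\<bar>c * m B\<bar> \<le> \<bar>c\<bar> * d"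
      unfolding abs_mult using less that by (intro mult_left_mono) (auto simp: less_imp_le)
    also have "\<dots> < (\<bar>c\<bar> + 1) * d" using d by (simp add: algebra_simps)
    also have "\<dots> = e" by (simp add: d_def)
    finally show ?thesis .
  qed
  with C show "\<exists>C. compact C \<and> C \<subseteq> A \<and> (\<forall>B\<in>sphere_borel. B \<subseteq> A - C \<longrightarrow> \<bar>c * m B\<bar> < e)"
    by blast
qed

lemma regular_add:
  assumes "regular_set_function m" "regular_set_function n"
  shows "regular_set_function (\<lambda>A. m A + n A)"
  unfolding regular_set_function_def
proof (intro ballI allI impI)
  fix A :: "'a set" and e :: real
  assume A: "A \<in> sphere_borel" and "0 < e"
  then have e: "e / 2 > 0" by simp
  obtain C where C: "compact C" "C \<subseteq> A" "\<forall>B\<in>sphere_borel. B \<subseteq> A - C \<longrightarrow> \<bar>m B\<bar> < e / 2"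
    using assms(1) A e unfolding regular_set_function_def by meson
  obtain D where D: "compact D" "D \<subseteq> A" "\<forall>B\<in>sphere_borel. B \<subseteq> A - D \<longrightarrow> \<bar>n B\<bar> < e / 2"
    using assms(2) A e unfolding regular_set_function_def by meson
  have "\<bar>m B + n B\<bar> < e" if B: "B \<in> sphere_borel" "B \<subseteq> A - (C \<union> D)" for B
  proof -
    have "B \<subseteq> A - C" "B \<subseteq> A - D" using B(2) by auto
    then have "\<bar>m B\<bar> < e / 2" "\<bar>n B\<bar> < e / 2" using C(3) D(3) B(1) by auto
    then show ?thesis by linarith
  qed
  with C D show "\<exists>C. compact C \<and> C \<subseteq> A \<and> (\<forall>B\<in>sphere_borel. B \<subseteq> A - C \<longrightarrow> \<bar>m B + n B\<bar> < e)"
    by (intro exI[of _ "C \<union> D"]) (auto intro: compact_Un)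
qed

instantiation sphere_measure :: (euclidean_space) real_vector
begin

lift_definition zero_sphere_measure :: "'a sphere_measure" is "\<lambda>_. 0"
  by (auto simp: signed_measure_def regular_set_function_def intro!: exI[of _ "{}"])

lift_definition plus_sphere_measure :: "'a sphere_measure \<Rightarrow> 'a sphere_measure \<Rightarrow> 'a sphere_measure"
  is "\<lambda>m n A. m A + n A"
  by (simp add: signed_measure_add regular_add)

lift_definition scaleR_sphere_measure :: "real \<Rightarrow> 'a sphere_measure \<Rightarrow> 'a sphere_measure"
  is "\<lambda>c m A. c * m A"
  by (simp add: signed_measure_scale regular_scale)

definition uminus_sphere_measure :: "'a sphere_measure \<Rightarrow> 'a sphere_measure" where
  "uminus_sphere_measure m = (-1) *\<^sub>R m"

definition minus_sphere_measure :: "'a sphere_measure \<Rightarrow> 'a sphere_measure \<Rightarrow> 'a sphere_measure" where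
  "minus_sphere_measure m n = m + (- n)"

instance
proof
  fix a b :: real and m n k :: "'a sphere_measure"
  show "m + n + k = m + (n + k)" by transfer (simp add: fun_eq_iff)
  show "m + n = n + m" by transfer (simp add: fun_eq_iff)
  show "0 + m = m" by transfer (simp add: fun_eq_iff)
  show "- m + m = 0" unfolding uminus_sphere_measure_def by transfer (simp add: fun_eq_iff)
  show "m - n = m + - n" by (simp add: minus_sphere_measure_def)
  show "a *\<^sub>R (m + n) = a *\<^sub>R m + a *\<^sub>R n" by transfer (simp add: fun_eq_iff distrib_left)
  show "(a + b) *\<^sub>R m = a *\<^sub>R m + b *\<^sub>R m" by transfer (simp add: fun_eq_iff distrib_right)
  show "a *\<^sub>R b *\<^sub>R m = (a * b) *\<^sub>R m" by transfer (simp add: fun_eq_iff)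
  show "1 *\<^sub>R m = m" by transfer (simp add: fun_eq_iff)
qed

end

lemma signed_measure_point: "signed_measure (\<lambda>A. if A \<in> sphere_borel then indicator A w else 0)"
  unfolding signed_measure_def
proof (intro allI impI)
  fix A :: "nat \<Rightarrow> 'a set"
  assume "range A \<subseteq> sphere_borel \<and> disjoint_family A"
  then have A: "\<And>i. A i \<in> sphere_borel" "disjoint_family A" by auto
  then have "(\<Union>i. A i) \<in> sphere_borel" by (auto simp: sphere_borel_def)
  moreover have "(\<lambda>i. indicator (A i) w :: real) sums indicator (\<Union>i. A i) w"
  proof (cases "\<exists>i. w \<in> A i")
    case True
    then obtain k where k: "w \<in> A k" by blast
    have "(\<lambda>i. indicator (A i) w :: real) = (\<lambda>i. if i = k then 1 else 0)"
    proof
      fix i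
      show "(indicator (A i) w :: real) = (if i = k then 1 else 0)"
        using A(2) k by (cases "i = k") (auto simp: disjoint_family_on_def indicator_def)
    qed
    then show ?thesis using sums_single[of k "\<lambda>_. 1 :: real"] k by (auto simp: indicator_def)
  next
    case False
    then have "(\<lambda>i. indicator (A i) w :: real) = (\<lambda>i. 0)" "indicator (\<Union>i. A i) w = (0 :: real)"
      by (auto simp: indicator_def)
    then show ?thesis by (simp only: sums_zero)
  qed
  ultimately show "(\<lambda>i. if A i \<in> sphere_borel then indicator (A i) w else 0 :: real) sums
      (if (\<Union>i. A i) \<in> sphere_borel then indicator (\<Union>i. A i) w else 0)"
    by (simp only: A(1) if_True)
qed

lemma regular_point: "regular_set_function (\<lambda>A. if A \<in> sphere_borel then indicator A w else 0)"
  unfolding regular_set_function_def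
proof (intro ballI allI impI)
  fix A :: "'a set" and e :: real
  assume "0 < e"
  then show "\<exists>C. compact C \<and> C \<subseteq> A \<and> (\<forall>B\<in>sphere_borel. B \<subseteq> A - C \<longrightarrow>
      \<bar>if B \<in> sphere_borel then indicator B w else 0 :: real\<bar> < e)"
    by (intro exI[of _ "{w} \<inter> A"]) (auto simp: Int_insert_left indicator_def)
qed

lift_definition dirac :: "'a::euclidean_space \<Rightarrow> 'a sphere_measure"
  is "\<lambda>w A. if A \<in> sphere_borel then indicator A w else 0"
  by (simp add: signed_measure_point regular_point)

text \<open>The real supremum is over a bounded set, since the variation of a finite signed measure is finite.\<close>

definition tv_norm :: "'a::euclidean_space sphere_measure \<Rightarrow> real" where
  "tv_norm \<mu> =
     (SUP P\<in>{P. finite P \<and> P \<subseteq> sphere_borel \<and> partition_on (sphere 0 1) P}. \<Sum>A\<in>P. \<bar>mass \<mu> A\<bar>)"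

text \<open>The positive part of the Jordan decomposition; the negative part of \<open>\<mu>\<close> is the positive part
  of \<open>- \<mu>\<close>.\<close>

definition pos_part :: "'a::euclidean_space sphere_measure \<Rightarrow> 'a measure" where
  "pos_part \<mu> = measure_of (sphere 0 1) sphere_borel
     (\<lambda>A. SUP B\<in>{B \<in> sphere_borel. B \<subseteq> A}. ennreal (mass \<mu> B))"

definition sphere_integral :: "'a::euclidean_space sphere_measure \<Rightarrow> ('a \<Rightarrow> real) \<Rightarrow> real" where
  "sphere_integral \<mu> f = (LINT w|pos_part \<mu>. f w) - (LINT w|pos_part (- \<mu>). f w)"

definition relu :: "real \<Rightarrow> real" where
  "relu z = max 0 z"

definition K_op :: "('n \<Rightarrow> real ^ 'd) \<Rightarrow> (real ^ 'd) sphere_measure \<Rightarrow> real ^ 'n" where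
  "K_op x \<mu> = (\<chi> j. sphere_integral \<mu> (\<lambda>w. relu (w \<bullet> x j)))"

definition K_adj :: "('n::finite \<Rightarrow> real ^ 'd) \<Rightarrow> real ^ 'n \<Rightarrow> real ^ 'd \<Rightarrow> real" where
  "K_adj x p w = (\<Sum>j\<in>UNIV. p $ j * relu (w \<bullet> x j))"

definition solves_P0 :: "('n::finite \<Rightarrow> real ^ 'd) \<Rightarrow> real ^ 'n \<Rightarrow> (real ^ 'd) sphere_measure \<Rightarrow> bool" where
  "solves_P0 x y \<mu> \<longleftrightarrow> is_arg_min tv_norm (\<lambda>\<nu>. K_op x \<nu> = y) \<mu>"

definition sphere_sup_norm :: "('a::euclidean_space \<Rightarrow> real) \<Rightarrow> real" where
  "sphere_sup_norm f = (SUP w\<in>sphere 0 1. \<bar>f w\<bar>)"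

text \<open>Elements of \<open>C(S)\<close> are represented by functions on the whole space of which only the values on
  the sphere \<open>S\<close> matter.\<close>

definition tv_subdifferential :: "'a::euclidean_space sphere_measure \<Rightarrow> ('a \<Rightarrow> real) set" where
  "tv_subdifferential \<mu> =
     {f. continuous_on (sphere 0 1) f \<and> sphere_sup_norm f \<le> 1 \<and> sphere_integral \<mu> f = tv_norm \<mu>}"

definition dual_certificate ::
    "('n::finite \<Rightarrow> real ^ 'd) \<Rightarrow> (real ^ 'd) sphere_measure \<Rightarrow> (real ^ 'd \<Rightarrow> real) \<Rightarrow> bool" where
  "dual_certificate x \<mu> \<eta> \<longleftrightarrow>
     (\<exists>p. \<forall>w\<in>sphere 0 1. \<eta> w = K_adj x p w) \<and> \<eta> \<in> tv_subdifferential \<mu>"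

text \<open>\<open>True\<close> and \<open>False\<close> encode the entries \<open>1\<close> and \<open>0\<close> of \<open>\<pi>\<close>.\<close>

definition act_region :: "('n::finite \<Rightarrow> real ^ 'd) \<Rightarrow> ('n \<Rightarrow> bool) \<Rightarrow> (real ^ 'd) set" where
  "act_region x \<pi> = {w. \<forall>j. (\<pi> j \<longrightarrow> w \<bullet> x j > 0) \<and> (\<not> \<pi> j \<longrightarrow> w \<bullet> x j < 0)}"

end

theory Submission
  imports Defs
begin

text \<open>Since \<open>\<eta>\<^sub>0 = K\<^sub>* p\<close>, the integral of \<open>\<eta>\<^sub>0\<close> against a feasible \<open>\<mu>\<close> is \<open>p \<bullet> y\<^sub>0 = \<parallel>\<mu>\<^sub>0\<parallel>\<close>; it is
  at most \<open>\<parallel>\<mu>\<parallel>\<close>, so \<open>\<mu>\<^sub>0\<close> is a minimizer. If \<open>\<mu>\<close> is another one, with positive and negative parts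
  \<open>P\<close> and \<open>Q\<close>, then \<open>1 - \<eta>\<^sub>0\<close> has \<open>P\<close>-integral 0 and \<open>1 + \<eta>\<^sub>0\<close> has \<open>Q\<close>-integral 0, so \<open>\<mu>\<close> lives on the
  points \<open>w\<^sub>i\<close>, where \<open>\<bar>\<eta>\<^sub>0\<bar>\<close> may be 1, and linear independence determines its weights. All that is
  needed of the Jordan decomposition is that \<open>P\<close> and \<open>Q\<close> are finite measures with \<open>\<mu> = P - Q\<close> and
  \<open>P S + Q S \<le> \<parallel>\<mu>\<parallel>\<close>, which follows from the definition as a supremum without a Hahn
  decomposition.\<close>

section \<open>Signed measures on the sphere: additivity and boundedness\<close>

lemma sphere_borel_sigma_algebra:
  "sigma_algebra (sphere 0 1) (sphere_borel :: 'a::euclidean_space set set)"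
proof -
  have "space (restrict_space borel (sphere 0 1)) = (sphere 0 1 :: 'a set)"
    by (simp add: space_restrict_space)
  then show ?thesis
    unfolding sphere_borel_def
    using sets.sigma_algebra_axioms[of "restrict_space borel (sphere 0 1 :: 'a set)"] by simp
qed

interpretation sphere_borel: sigma_algebra "sphere 0 1" "sphere_borel :: 'a::euclidean_space set set"
  by (rule sphere_borel_sigma_algebra)

lemma sphere_borel_finite:
  fixes A :: "'a::euclidean_space set"
  assumes "finite A" "A \<subseteq> sphere 0 1"
  shows "A \<in> sphere_borel"
  using assms unfolding sphere_borel_def
  by (auto simp: sets_restrict_space_iff intro: borel_closed finite_imp_closed)

text \<open>The constant family of empty sets is disjoint, and a constant series converges only if
  its term is 0.\<close>

lemma signed_measure_empty:
  assumes "signed_measure m"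
  shows "m {} = 0"
proof -
  have "(\<lambda>i::nat. m {}) sums m (\<Union>i::nat. {})"
    using assms unfolding signed_measure_def
    by (elim allE[of _ "\<lambda>_. {}"]) (auto simp: disjoint_family_on_def)
  then have "summable (\<lambda>i::nat. m {})" by (rule sums_summable)
  then show ?thesis by (simp add: summable_const_iff)
qed

lemma signed_measure_Un:
  assumes "signed_measure m" "A \<in> sphere_borel" "B \<in> sphere_borel" "A \<inter> B = {}"
  shows "m (A \<union> B) = m A + m B"
proof -
  have "(\<lambda>i. m (binaryset A B i)) sums m (\<Union>i. binaryset A B i)"
    using assms unfolding signed_measure_def
    by (elim allE[of _ "binaryset A B"]) (auto simp: disjoint_family_on_def range_binaryset_eq binaryset_def split: if_splits)
  moreover have "(\<lambda>i. m (binaryset A B i)) sums (m A + m B)"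
    by (rule binaryset_sums) (rule signed_measure_empty[OF assms(1)])
  ultimately show ?thesis by (simp add: UN_binaryset_eq sums_iff)
qed

lemma signed_measure_split:
  assumes "signed_measure m" "A \<in> sphere_borel" "B \<in> sphere_borel"
  shows "m A = m (A \<inter> B) + m (A - B)"
proof -
  have "m ((A \<inter> B) \<union> (A - B)) = m (A \<inter> B) + m (A - B)"
    using assms by (intro signed_measure_Un) auto
  moreover have "(A \<inter> B) \<union> (A - B) = A" by blast
  ultimately show ?thesis by simp
qed

lemma signed_measure_bounded:
  fixes m :: "'a::euclidean_space set \<Rightarrow> real"
  assumes m: "signed_measure m"
  shows "\<exists>C. \<forall>B\<in>sphere_borel. \<bar>m B\<bar> \<le> C"
proof (rule ccontr)
  define unb where "unb A \<longleftrightarrow> A \<in> sphere_borel \<and> (\<forall>C. \<exists>B\<in>sphere_borel. B \<subseteq> A \<and> \<bar>m B\<bar> > C)" for A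
  assume "\<not> ?thesis"
  \<comment> \<open>Otherwise, splitting off sets of mass at least 1 while keeping an unbounded remainder gives
    disjoint sets whose masses are not summable.\<close>
  then have S: "unb (sphere 0 1)"
    unfolding unb_def by (metis not_le sphere_borel.sets_into_space sphere_borel.top)
  have step: "\<exists>A'. unb A' \<and> A' \<subseteq> A \<and> \<bar>m (A - A')\<bar> > 1" if A: "unb A" for A
  proof -
    \<comment> \<open>The threshold \<open>1 + \<bar>m A\<bar>\<close> makes the masses of both
      \<open>B\<close> and \<open>A - B\<close> exceed 1 in absolute value, so either one may be
      split off, whichever leaves an unbounded rest.\<close>
    obtain B where B: "B \<in> sphere_borel" "B \<subseteq> A" "\<bar>m B\<bar> > 1 + \<bar>m A\<bar>"
      using A unfolding unb_def by blast
    have Am: "A \<in> sphere_borel" using A by (simp add: unb_def)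
    have "A \<inter> B = B" using B by blast
    then have eq: "m A = m B + m (A - B)" using signed_measure_split[OF m Am B(1)] by simp
    show ?thesis
    proof (cases "unb B")
      case True
      have "\<bar>m (A - B)\<bar> > 1" using eq B(3) by linarith
      then show ?thesis using True B by blast
    next
      case False
      then obtain C0 where C0: "\<And>D. D \<in> sphere_borel \<Longrightarrow> D \<subseteq> B \<Longrightarrow> \<bar>m D\<bar> \<le> C0"
        using B(1) unfolding unb_def by (auto simp: not_less)
      have "unb (A - B)"
        unfolding unb_def
      proof (intro conjI allI)
        show "A - B \<in> sphere_borel" using Am B by blast
        fix C
        \<comment> \<open>The surplus \<open>C0\<close> pays for the part of \<open>D\<close> inside
          \<open>B\<close>, where \<open>m\<close> is bounded by \<open>C0\<close>.\<close>
        obtain D where D: "D \<in> sphere_borel" "D \<subseteq> A" "\<bar>m D\<bar> > C + C0"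
          using A unfolding unb_def by blast
        have "m D = m (D \<inter> B) + m (D - B)" by (rule signed_measure_split[OF m D(1) B(1)])
        moreover have "\<bar>m (D \<inter> B)\<bar> \<le> C0" using D B by (intro C0) auto
        ultimately have "\<bar>m (D - B)\<bar> > C" using D(3) by linarith
        then show "\<exists>E\<in>sphere_borel. E \<subseteq> A - B \<and> \<bar>m E\<bar> > C"
          using D B by (intro bexI[of _ "D - B"]) auto
      qed
      moreover have "A - (A - B) = B" using B by blast
      ultimately show ?thesis using B(3) by (intro exI[of _ "A - B"]) auto
    qed
  qed
  obtain F where F: "\<And>n. unb (F n)" "\<And>n. F (Suc n) \<subseteq> F n" "\<And>n. \<bar>m (F n - F (Suc n))\<bar> > 1"
    using dependent_nat_choice[of "\<lambda>_. unb" "\<lambda>_ A A'. A' \<subseteq> A \<and> \<bar>m (A - A')\<bar> > 1"] S step by metis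
  define D where "D n = F n - F (Suc n)" for n
  \<comment> \<open>Successive differences are disjoint for increasing sequences; complements turn
    the decreasing \<open>F\<close> into one without changing the differences.\<close>
  have "disjoint_family (\<lambda>n. - F (Suc n) - - F n)"
    by (rule disjoint_family_Suc) (use F(2) in auto)
  moreover have "(\<lambda>n. - F (Suc n) - - F n) = D" by (auto simp: D_def)
  ultimately have "disjoint_family D" by simp
  moreover have "range D \<subseteq> sphere_borel" using F(1) by (auto simp: D_def unb_def)
  ultimately have "(\<lambda>i. m (D i)) sums m (\<Union>i. D i)" using m by (simp add: signed_measure_def)
  then have "(\<lambda>i. m (D i)) \<longlonglongrightarrow> 0" by (intro summable_LIMSEQ_zero sums_summable)
  then have "\<forall>\<^sub>F i in sequentially. dist (m (D i)) 0 < 1" by (rule tendstoD) simp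
  then have "\<exists>i. dist (m (D i)) 0 < 1" by (auto simp: eventually_sequentially)
  then obtain i where "\<bar>m (D i)\<bar> < 1" by auto
  then show False using F(3)[of i] by (simp add: D_def)
qed

section \<open>The positive variation as a measure\<close>

text \<open>The set function inside \<open>pos_part\<close>, for an arbitrary \<open>m\<close>. The
  truncation of negative values by \<open>ennreal\<close> is harmless for a signed measure, since
  the empty set already contributes 0.\<close>

definition pos_variation :: "('a::euclidean_space set \<Rightarrow> real) \<Rightarrow> 'a set \<Rightarrow> ennreal" where
  "pos_variation m A = (SUP B\<in>{B \<in> sphere_borel. B \<subseteq> A}. ennreal (m B))"

lemma pos_variation_upper:
  "B \<in> sphere_borel \<Longrightarrow> B \<subseteq> A \<Longrightarrow> ennreal (m B) \<le> pos_variation m A"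
  unfolding pos_variation_def by (rule SUP_upper) auto

lemma pos_variation_mono: "A \<subseteq> B \<Longrightarrow> pos_variation m A \<le> pos_variation m B"
  unfolding pos_variation_def by (rule SUP_subset_mono) auto

text \<open>A competitor \<open>C\<close> for \<open>A\<close> and a competitor \<open>D\<close> for
  \<open>B\<close> are disjoint, so \<open>m\<close> is additive on their union, which competes for
  \<open>A \<union> B\<close>.\<close>

lemma pos_variation_superadditive:
  assumes m: "signed_measure m" and "A \<inter> B = {}"
  shows "pos_variation m A + pos_variation m B \<le> pos_variation m (A \<union> B)"
proof -
  have ne: "{B \<in> sphere_borel. B \<subseteq> X} \<noteq> {}" for X :: "'a set" by auto
  have *: "ennreal (m C) + ennreal (m D) \<le> pos_variation m (A \<union> B)"
    if "C \<in> sphere_borel" "C \<subseteq> A" "D \<in> sphere_borel" "D \<subseteq> B" for C D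
  proof -
    \<comment> \<open>A negative value is truncated to 0, and then the other set alone is a
      sufficient competitor.\<close>
    consider "m C < 0" | "m D < 0" | "m C \<ge> 0" "m D \<ge> 0" by linarith
    then show ?thesis
    proof cases
      case 3
      have "ennreal (m C) + ennreal (m D) = ennreal (m (C \<union> D))"
        using 3 signed_measure_Un[OF m that(1,3)] that assms(2)
        by (subst ennreal_plus[symmetric]) (simp, simp, metis disjoint_iff subset_iff)
      also have "\<dots> \<le> pos_variation m (A \<union> B)" using that by (intro pos_variation_upper) auto
      finally show ?thesis .
    qed (use that in \<open>auto simp: ennreal_neg intro!: pos_variation_upper\<close>)
  qed
  have "pos_variation m A + pos_variation m B
      = (SUP C\<in>{C \<in> sphere_borel. C \<subseteq> A}. ennreal (m C) + pos_variation m B)"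
    unfolding pos_variation_def[of m A] using ne by (subst ennreal_SUP_add_left) auto
  also have "\<dots> = (SUP C\<in>{C \<in> sphere_borel. C \<subseteq> A}. SUP D\<in>{D \<in> sphere_borel. D \<subseteq> B}.
      ennreal (m C) + ennreal (m D))"
    unfolding pos_variation_def[of m B] using ne by (subst ennreal_SUP_add_right) auto
  also have "\<dots> \<le> pos_variation m (A \<union> B)" using * by (intro SUP_least) auto
  finally show ?thesis .
qed

text \<open>Truncation at 0 is subadditive; the terms \<open>f i\<close> may have any sign.\<close>

lemma ennreal_sum_le: "ennreal (\<Sum>i\<in>I. f i) \<le> (\<Sum>i\<in>I. ennreal (f i))"
proof (induction I rule: infinite_finite_induct)
  case (insert i I)
  have "ennreal (f i + (\<Sum>i\<in>I. f i)) \<le> ennreal (f i) + ennreal (\<Sum>i\<in>I. f i)"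
    by (auto simp: ennreal_plus_if intro: ennreal_leI)
  then show ?case using insert by (auto intro: order_trans add_left_mono)
qed auto

text \<open>One inequality is the limit of finite superadditivity. For the other, a competitor
  \<open>B\<close> for the union is cut into the pieces \<open>B \<inter> A i\<close>, each a
  competitor for \<open>A i\<close>, and countable additivity of \<open>m\<close> reassembles
  them.\<close>

lemma countably_additive_pos_variation:
  fixes m :: "'a::euclidean_space set \<Rightarrow> real"
  assumes m: "signed_measure m"
  shows "countably_additive sphere_borel (pos_variation m)"
  unfolding countably_additive_def
proof (intro allI impI antisym)
  fix A :: "nat \<Rightarrow> 'a set"
  assume A: "range A \<subseteq> sphere_borel" "disjoint_family A"
  have "(\<Sum>i<n. pos_variation m (A i)) \<le> pos_variation m (\<Union>i<n. A i)" for n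
  proof (induction n)
    case (Suc n)
    have "A n \<inter> (\<Union>i<n. A i) = {}"
      using A(2) unfolding disjoint_family_on_def by (auto simp: disjoint_iff) (metis less_irrefl)
    from pos_variation_superadditive[OF m this] Suc show ?case
      by (simp add: lessThan_Suc add.commute) (metis add_mono_thms_linordered_semiring(2) order_trans)
  qed simp
  also have "pos_variation m (\<Union>i<n. A i) \<le> pos_variation m (\<Union>i. A i)" for n
    by (rule pos_variation_mono) auto
  finally show "(\<Sum>i. pos_variation m (A i)) \<le> pos_variation m (\<Union>i. A i)"
    by (simp add: suminf_eq_SUP SUP_least)
  show "pos_variation m (\<Union>i. A i) \<le> (\<Sum>i. pos_variation m (A i))"
    unfolding pos_variation_def[of m "\<Union>i. A i"]
  proof (rule SUP_least, safe)
    fix B assume B: "B \<in> sphere_borel" "B \<subseteq> (\<Union>i. A i)"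
    have "(\<lambda>i. m (B \<inter> A i)) sums m (\<Union>i. B \<inter> A i)"
      using m A B unfolding signed_measure_def
      by (elim allE[of _ "\<lambda>i. B \<inter> A i"]) (auto simp: disjoint_family_on_def)
    moreover have "(\<Union>i. B \<inter> A i) = B" using B by blast
    ultimately have "(\<lambda>n. ennreal (\<Sum>i<n. m (B \<inter> A i))) \<longlonglongrightarrow> ennreal (m B)"
      by (intro tendsto_ennrealI) (simp add: sums_def)
    moreover have "ennreal (\<Sum>i<n. m (B \<inter> A i)) \<le> (\<Sum>i. pos_variation m (A i))" for n
    proof -
      have "ennreal (\<Sum>i<n. m (B \<inter> A i)) \<le> (\<Sum>i<n. ennreal (m (B \<inter> A i)))"
        by (rule ennreal_sum_le)
      also have "\<dots> \<le> (\<Sum>i<n. pos_variation m (A i))"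
        using A B by (intro sum_mono pos_variation_upper) auto
      also have "\<dots> \<le> (\<Sum>i. pos_variation m (A i))" by (rule sum_le_suminf) auto
      finally show ?thesis .
    qed
    ultimately show "ennreal (m B) \<le> (\<Sum>i. pos_variation m (A i))"
      by (intro LIMSEQ_le_const2) auto
  qed
qed

section \<open>Positive and negative parts of a measure\<close>

lemma signed_measure_mass: "signed_measure (mass \<mu>)"
  using mass[of \<mu>] by auto

lemma mass_uminus: "mass (- \<mu>) A = - mass \<mu> A"
  unfolding uminus_sphere_measure_def scaleR_sphere_measure.rep_eq by simp

lemma mass_outside: "A \<notin> sphere_borel \<Longrightarrow> mass \<mu> A = 0"
  using mass[of \<mu>] by auto

lemma sets_pos_part [simp, measurable_cong]: "sets (pos_part \<mu>) = sphere_borel"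
  unfolding pos_part_def by (simp add: sphere_borel.space_closed sphere_borel.sigma_sets_eq)

lemma space_pos_part [simp]: "space (pos_part \<mu>) = sphere 0 1"
  unfolding pos_part_def by (simp add: sphere_borel.space_closed space_measure_of)

lemma emeasure_pos_part:
  assumes "A \<in> sphere_borel"
  shows "emeasure (pos_part \<mu>) A = pos_variation (mass \<mu>) A"
proof -
  have "positive sphere_borel (pos_variation (mass \<mu>))"
    unfolding positive_def pos_variation_def
    using signed_measure_empty[OF signed_measure_mass[of \<mu>]] by auto
  then show ?thesis
    unfolding pos_part_def pos_variation_def[symmetric]
    using countably_additive_pos_variation[OF signed_measure_mass[of \<mu>]] assms
    by (intro emeasure_measure_of_sigma sphere_borel_sigma_algebra)
qed

lemma finite_measure_pos_part: "finite_measure (pos_part \<mu>)"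
proof
  obtain C where C: "\<And>B. B \<in> sphere_borel \<Longrightarrow> \<bar>mass \<mu> B\<bar> \<le> C"
    using signed_measure_bounded[OF signed_measure_mass[of \<mu>]] by blast
  have "pos_variation (mass \<mu>) (sphere 0 1) \<le> ennreal C"
    unfolding pos_variation_def using C by (intro SUP_least ennreal_leI) (auto dest: abs_le_D1)
  then show "emeasure (pos_part \<mu>) (space (pos_part \<mu>)) \<noteq> \<infinity>"
    by (simp add: emeasure_pos_part) (metis ennreal_less_top infinity_ennreal_def leD)
qed

lemma mass_le_pos_part:
  assumes "A \<in> sphere_borel" "B \<in> sphere_borel" "B \<subseteq> A"
  shows "mass \<mu> B \<le> measure (pos_part \<mu>) A"
proof -
  interpret finite_measure "pos_part \<mu>" by (rule finite_measure_pos_part)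
  have "ennreal (mass \<mu> B) \<le> ennreal (measure (pos_part \<mu>) A)"
    using pos_variation_upper[OF assms(2,3), of "mass \<mu>"] emeasure_pos_part[OF assms(1), of \<mu>]
    by (simp add: emeasure_eq_measure)
  then show ?thesis by (simp add: ennreal_le_iff)
qed

text \<open>The least-upper-bound half of the supremum in real terms;
  \<open>mass_le_pos_part\<close> is the upper-bound half.\<close>

lemma pos_part_le:
  assumes "A \<in> sphere_borel" "\<And>B. B \<in> sphere_borel \<Longrightarrow> B \<subseteq> A \<Longrightarrow> mass \<mu> B \<le> c"
  shows "measure (pos_part \<mu>) A \<le> c"
proof -
  interpret finite_measure "pos_part \<mu>" by (rule finite_measure_pos_part)
  \<comment> \<open>The empty set as competitor gives the sign of \<open>c\<close>, so that
    \<open>ennreal c\<close> does not truncate and the bound survives in the reals.\<close>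
  have "0 \<le> c" using assms(2)[of "{}"] signed_measure_empty[OF signed_measure_mass[of \<mu>]] by simp
  have "emeasure (pos_part \<mu>) A \<le> ennreal c"
    unfolding emeasure_pos_part[OF assms(1)] pos_variation_def
    using assms(2) by (intro SUP_least ennreal_leI) auto
  then show ?thesis using \<open>0 \<le> c\<close> by (simp add: emeasure_eq_measure)
qed

text \<open>For \<open>B \<subseteq> A\<close> the identity
  \<open>\<mu> B = \<mu> A + (- \<mu>) (A - B)\<close> pairs the competitors of the two suprema.
  Taking the supremum over \<open>B\<close> bounds each part by the other, shifted by
  \<open>\<mu> A\<close>.\<close>

lemma mass_eq_pos_part_diff:
  assumes A: "A \<in> sphere_borel"
  shows "mass \<mu> A = measure (pos_part \<mu>) A - measure (pos_part (- \<mu>)) A"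
proof -
  have split: "mass \<mu> A = mass \<mu> B + mass \<mu> (A - B)" if "B \<in> sphere_borel" "B \<subseteq> A" for B
    using signed_measure_split[OF signed_measure_mass[of \<mu>] A that(1)] that(2)
    by (simp add: Int_absorb1)
  have "measure (pos_part \<mu>) A \<le> mass \<mu> A + measure (pos_part (- \<mu>)) A"
  proof (rule pos_part_le[OF A])
    fix B assume B: "B \<in> sphere_borel" "B \<subseteq> A"
    have "mass (- \<mu>) (A - B) \<le> measure (pos_part (- \<mu>)) A"
      using A B by (intro mass_le_pos_part) auto
    then show "mass \<mu> B \<le> mass \<mu> A + measure (pos_part (- \<mu>)) A"
      using split[OF B] by (simp add: mass_uminus)
  qed
  moreover have "measure (pos_part (- \<mu>)) A \<le> measure (pos_part \<mu>) A - mass \<mu> A"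
  proof (rule pos_part_le[OF A])
    fix B assume B: "B \<in> sphere_borel" "B \<subseteq> A"
    have "mass \<mu> (A - B) \<le> measure (pos_part \<mu>) A"
      using A B by (intro mass_le_pos_part) auto
    then show "mass (- \<mu>) B \<le> measure (pos_part \<mu>) A - mass \<mu> A"
      using split[OF B] by (simp add: mass_uminus)
  qed
  ultimately show ?thesis by linarith
qed

text \<open>The partition into \<open>B\<close> and its complement bounds
  \<open>\<mu> B - \<mu> (S - B)\<close> by the norm; adding
  \<open>\<mu> S = \<mu> B + \<mu> (S - B)\<close> gives
  \<open>2 * \<mu> B \<le> \<parallel>\<mu>\<parallel> + \<mu> S\<close>, and the supremum over
  \<open>B\<close> is the positive part of \<open>S\<close>.\<close>

lemma tv_norm_ge:
  "measure (pos_part \<mu>) (sphere 0 1) + measure (pos_part (- \<mu>)) (sphere 0 1) \<le> tv_norm \<mu>"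
proof -
  interpret P: finite_measure "pos_part \<mu>" by (rule finite_measure_pos_part)
  interpret Q: finite_measure "pos_part (- \<mu>)" by (rule finite_measure_pos_part)
  let ?p = "\<lambda>A. measure (pos_part \<mu>) A" and ?q = "\<lambda>A. measure (pos_part (- \<mu>)) A"
  let ?S = "sphere 0 1 :: 'a set"
  let ?Part = "{P. finite P \<and> P \<subseteq> sphere_borel \<and> partition_on ?S P}"
  have S: "?S \<in> sphere_borel" by (rule sphere_borel.top)
  have m0: "mass \<mu> {} = 0" by (rule signed_measure_empty[OF signed_measure_mass])
  \<comment> \<open>A real supremum dominates its members only over a bounded set; the total mass of
    the two parts is a bound.\<close>
  have bdd: "bdd_above ((\<lambda>P. \<Sum>A\<in>P. \<bar>mass \<mu> A\<bar>) ` ?Part)"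
  proof (rule bdd_aboveI2)
    fix P assume P: "P \<in> ?Part"
    have disj: "disjoint_family_on (\<lambda>A. A) P"
      using P by (auto simp: partition_on_def disjoint_family_on_def disjoint_def)
    have "(\<Sum>A\<in>P. \<bar>mass \<mu> A\<bar>) \<le> (\<Sum>A\<in>P. ?p A + ?q A)"
    proof (rule sum_mono)
      fix A assume "A \<in> P"
      then have "A \<in> sphere_borel" using P by auto
      then show "\<bar>mass \<mu> A\<bar> \<le> ?p A + ?q A"
        unfolding mass_eq_pos_part_diff[OF \<open>A \<in> sphere_borel\<close>] using measure_nonneg[of "pos_part \<mu>" A]
          measure_nonneg[of "pos_part (- \<mu>)" A] by linarith
    qed
    also have "\<dots> = ?p (\<Union>A\<in>P. A) + ?q (\<Union>A\<in>P. A)"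
      unfolding sum.distrib using P disj
      by (subst P.finite_measure_finite_Union, simp, force, simp,
          subst Q.finite_measure_finite_Union, simp, force, simp) simp
    also have "(\<Union>A\<in>P. A) = ?S" using P by (auto simp: partition_on_def)
    finally show "(\<Sum>A\<in>P. \<bar>mass \<mu> A\<bar>) \<le> ?p ?S + ?q ?S" .
  qed
  have "?p ?S \<le> (tv_norm \<mu> + mass \<mu> ?S) / 2"
  proof (rule pos_part_le[OF S])
    fix B :: "'a set" assume B: "B \<in> sphere_borel" "B \<subseteq> ?S"
    \<comment> \<open>\<open>partition_on\<close> forbids empty blocks; removing them leaves the sum
      unchanged.\<close>
    let ?P = "{B, ?S - B} - {{}}"
    have "?P \<in> ?Part"
      using B S by (auto simp: partition_on_def disjoint_def)
    then have "(\<Sum>A\<in>?P. \<bar>mass \<mu> A\<bar>) \<le> tv_norm \<mu>"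
      unfolding tv_norm_def by (rule cSUP_upper) (rule bdd)
    moreover have "(\<Sum>A\<in>?P. \<bar>mass \<mu> A\<bar>) = \<bar>mass \<mu> B\<bar> + \<bar>mass \<mu> (?S - B)\<bar>"
    proof -
      have "(\<Sum>A\<in>?P. \<bar>mass \<mu> A\<bar>) = (\<Sum>A\<in>{B, ?S - B}. \<bar>mass \<mu> A\<bar>)"
        by (rule sum.mono_neutral_left) (auto simp: m0)
      also have "\<dots> = \<bar>mass \<mu> B\<bar> + \<bar>mass \<mu> (?S - B)\<bar>"
      \<comment> \<open>If the two blocks coincided, the sum would count them once; this would force
        the unit sphere to be empty.\<close>
      proof (cases "B = ?S - B")
        case True
        then have "B = {}" by blast
        then have "?S = {}" using True by blast
        then show ?thesis unfolding sphere_eq_empty by simp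
      qed simp
      finally show ?thesis .
    qed
    ultimately have "\<bar>mass \<mu> B\<bar> + \<bar>mass \<mu> (?S - B)\<bar> \<le> tv_norm \<mu>" by simp
    moreover have "mass \<mu> ?S = mass \<mu> B + mass \<mu> (?S - B)"
      using signed_measure_split[OF signed_measure_mass[of \<mu>] S B(1)] B(2) by (simp add: Int_absorb1)
    ultimately show "mass \<mu> B \<le> (tv_norm \<mu> + mass \<mu> ?S) / 2"
      using abs_ge_self[of "mass \<mu> B"] abs_ge_minus_self[of "mass \<mu> (?S - B)"] by simp
  qed
  \<comment> \<open>Substituting \<open>\<mu> S = P S - Q S\<close> into
    \<open>2 * P S \<le> \<parallel>\<mu>\<parallel> + \<mu> S\<close> leaves the claim.\<close>
  then show ?thesis using mass_eq_pos_part_diff[OF S, of \<mu>] by (simp add: field_simps)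
qed

section \<open>Integration of continuous functions on the sphere\<close>

lemma borel_measurable_pos_part:
  assumes "continuous_on (sphere 0 1) f"
  shows "f \<in> borel_measurable (pos_part \<mu>)"
proof -
  have "f \<in> borel_measurable (restrict_space borel (sphere 0 1))"
    by (rule borel_measurable_continuous_on_restrict[OF assms])
  moreover have "measurable (pos_part \<mu>) (borel :: 'b measure)
      = measurable (restrict_space borel (sphere 0 1)) borel"
    by (rule measurable_cong_sets) (auto simp: sphere_borel_def)
  ultimately show ?thesis by simp
qed

lemma integrable_pos_part:
  fixes f :: "'a::euclidean_space \<Rightarrow> real"
  assumes f: "continuous_on (sphere 0 1) f"
  shows "integrable (pos_part \<mu>) f"
proof -
  interpret finite_measure "pos_part \<mu>" by (rule finite_measure_pos_part)
  have "bounded (f ` sphere 0 1)"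
    by (intro compact_imp_bounded compact_continuous_image f compact_sphere)
  then obtain C where "\<And>v. v \<in> sphere 0 1 \<Longrightarrow> norm (f v) \<le> C" unfolding bounded_iff by blast
  then show ?thesis
    by (intro integrable_const_bound[of _ C] borel_measurable_pos_part[OF f] AE_I2) simp
qed

lemma sphere_integral_cong:
  "(\<And>v. v \<in> sphere 0 1 \<Longrightarrow> f v = g v) \<Longrightarrow> sphere_integral \<mu> f = sphere_integral \<mu> g"
  unfolding sphere_integral_def by (intro arg_cong2[of _ _ _ _ "(-)"] Bochner_Integration.integral_cong) auto

lemma continuous_on_relu_inner: "continuous_on S (\<lambda>w. relu (w \<bullet> a))"
  unfolding relu_def by (intro continuous_intros)

text \<open>Adjointness of \<open>K_adj\<close> and \<open>K_op\<close>: each ReLU term is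
  integrable, so the finite sum leaves the integral.\<close>

lemma sphere_integral_K_adj: "sphere_integral \<mu> (K_adj x p) = p \<bullet> K_op x \<mu>"
proof -
  have "integrable (pos_part \<nu>) (\<lambda>w. relu (w \<bullet> x j))" for \<nu> j
    by (intro integrable_pos_part continuous_on_relu_inner)
  then show ?thesis
    by (simp add: sphere_integral_def K_adj_def[abs_def] K_op_def inner_vec_def sum_subtractf right_diff_distrib)
qed

section \<open>Measures concentrated on finitely many points\<close>

lemma integral_pos_part_concentrated:
  fixes f :: "'a::euclidean_space \<Rightarrow> real"
  assumes W: "finite W" "W \<subseteq> sphere 0 1"
    and null: "measure (pos_part \<mu>) (sphere 0 1 - W) = 0"
    and f: "continuous_on (sphere 0 1) f"
  shows "(LINT v|pos_part \<mu>. f v) = (\<Sum>v\<in>W. f v * measure (pos_part \<mu>) {v})"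
proof -
  interpret finite_measure "pos_part \<mu>" by (rule finite_measure_pos_part)
  have sing: "{v} \<in> sphere_borel" if "v \<in> W" for v
    using W that by (intro sphere_borel_finite) auto
  have N: "sphere 0 1 - W \<in> null_sets (pos_part \<mu>)"
    using W null sphere_borel_finite[of W] by (auto simp: null_sets_def emeasure_eq_measure)
  have WM: "W \<in> sphere_borel" by (rule sphere_borel_finite[OF W])
  have "(LINT v|pos_part \<mu>. f v) = (LINT v|pos_part \<mu>. f v * indicator W v)"
  proof (rule integral_cong_AE)
    show f: "f \<in> borel_measurable (pos_part \<mu>)" by (rule borel_measurable_pos_part[OF f])
    then show "(\<lambda>v. f v * indicator W v) \<in> borel_measurable (pos_part \<mu>)"
      using WM by (intro borel_measurable_times borel_measurable_indicator) simp_all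
    show "AE v in pos_part \<mu>. f v = f v * indicator W v"
      by (rule AE_I'[OF N]) auto
  qed
  also have "\<dots> = (\<Sum>v\<in>W. f v * measure (pos_part \<mu>) {v})"
    using sing by (intro integral_indicator_finite_real W) (simp_all add: less_top[symmetric])
  finally show ?thesis .
qed

text \<open>All Borel sets off \<open>W\<close> are tested because positive and negative mass could
  cancel on the whole complement.\<close>

definition concentrated_on :: "'a::euclidean_space set \<Rightarrow> 'a sphere_measure \<Rightarrow> bool" where
  "concentrated_on W \<mu> \<longleftrightarrow> (\<forall>B\<in>sphere_borel. B \<inter> W = {} \<longrightarrow> mass \<mu> B = 0)"

text \<open>Every competitor inside the complement of \<open>W\<close> has mass 0, so both parts
  vanish there and each integral is a finite sum.\<close>

lemma sphere_integral_concentrated: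
  assumes W: "finite W" "W \<subseteq> sphere 0 1" and \<mu>: "concentrated_on W \<mu>"
    and f: "continuous_on (sphere 0 1) f"
  shows "sphere_integral \<mu> f = (\<Sum>v\<in>W. mass \<mu> {v} * f v)"
proof -
  have SW: "sphere 0 1 - W \<in> sphere_borel" using sphere_borel_finite[OF W] by auto
  have null: "measure (pos_part \<nu>) (sphere 0 1 - W) = 0" if "concentrated_on W \<nu>" for \<nu>
    using that SW by (intro antisym measure_nonneg pos_part_le) (auto simp: concentrated_on_def)
  have "concentrated_on W (- \<mu>)" using \<mu> by (simp add: concentrated_on_def mass_uminus)
  moreover have "mass \<mu> {v} = measure (pos_part \<mu>) {v} - measure (pos_part (- \<mu>)) {v}" if "v \<in> W" for v
    using W that by (intro mass_eq_pos_part_diff sphere_borel_finite) auto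
  ultimately show ?thesis
    unfolding sphere_integral_def integral_pos_part_concentrated[OF W null[OF \<mu>] f]
      integral_pos_part_concentrated[OF W null[OF \<open>concentrated_on W (- \<mu>)\<close>] f]
    by (subst sum_subtractf[symmetric], intro sum.cong) (simp_all add: right_diff_distrib mult.commute)
qed

lemma concentrated_on_dirac: "concentrated_on {v} (dirac v)"
  by (auto simp: concentrated_on_def dirac.rep_eq)

lemma K_op_dirac:
  assumes "v \<in> sphere 0 1"
  shows "K_op x (dirac v) $ j = relu (v \<bullet> x j)"
proof -
  have "mass (dirac v) {v} = 1"
    using assms by (auto simp: dirac.rep_eq intro: sphere_borel_finite)
  then show ?thesis
    using assms sphere_integral_concentrated[OF _ _ concentrated_on_dirac continuous_on_relu_inner, of v "x j"]
    by (simp add: K_op_def)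
qed

lemma K_op_concentrated:
  assumes "finite W" "W \<subseteq> sphere 0 1" "concentrated_on W \<mu>"
  shows "K_op x \<mu> = (\<Sum>v\<in>W. mass \<mu> {v} *\<^sub>R K_op x (dirac v))"
proof (subst vec_eq_iff, intro allI)
  fix j
  have "K_op x \<mu> $ j = (\<Sum>v\<in>W. mass \<mu> {v} * relu (v \<bullet> x j))"
    unfolding K_op_def by (simp add: sphere_integral_concentrated[OF assms continuous_on_relu_inner])
  also have "\<dots> = (\<Sum>v\<in>W. mass \<mu> {v} *\<^sub>R K_op x (dirac v)) $ j"
    using assms(2) by (auto simp: K_op_dirac intro!: sum.cong)
  finally show "K_op x \<mu> $ j = (\<Sum>v\<in>W. mass \<mu> {v} *\<^sub>R K_op x (dirac v)) $ j" .
qed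

text \<open>The mass of a Borel set is the sum of the point masses over its intersection with
  \<open>W\<close>; off the Borel sets both measures are 0 by the choice of the type.\<close>

lemma concentrated_on_eqI:
  assumes W: "finite W" "W \<subseteq> sphere 0 1"
    and \<mu>: "concentrated_on W \<mu>" and \<nu>: "concentrated_on W \<nu>"
    and eq: "\<And>v. v \<in> W \<Longrightarrow> mass \<mu> {v} = mass \<nu> {v}"
  shows "\<mu> = \<nu>"
proof -
  have fin: "mass \<rho> V = (\<Sum>v\<in>V. mass \<rho> {v})" if "V \<subseteq> W" for V and \<rho> :: "'a sphere_measure"
    using finite_subset[OF that W(1)] that
  proof (induction V rule: finite_induct)
    case empty
    then show ?case by (simp add: signed_measure_empty[OF signed_measure_mass])
  next
    case (insert v V)
    have "mass \<rho> ({v} \<union> V) = mass \<rho> {v} + mass \<rho> V"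
      using insert W by (intro signed_measure_Un signed_measure_mass sphere_borel_finite) auto
    then show ?case using insert by simp
  qed
  have conc: "mass \<rho> A = (\<Sum>v\<in>A \<inter> W. mass \<rho> {v})" if "concentrated_on W \<rho>" "A \<in> sphere_borel" for A \<rho>
    using signed_measure_split[OF signed_measure_mass that(2) sphere_borel_finite[OF W], of \<rho>]
      that sphere_borel_finite[OF W] fin[of "A \<inter> W" \<rho>]
    by (auto simp: concentrated_on_def)
  have "mass \<mu> A = mass \<nu> A" for A
  proof (cases "A \<in> sphere_borel")
    case True
    then show ?thesis using eq by (simp add: conc \<mu> \<nu>)
  qed (simp add: mass_outside)
  then show ?thesis by (simp add: mass_inject[symmetric] fun_eq_iff)
qed

section \<open>Weak duality and its equality case\<close>

lemma measure_eq_0_if_integral_eq_0: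
  fixes g :: "'a \<Rightarrow> real"
  assumes "integrable M g" "\<And>v. v \<in> space M \<Longrightarrow> 0 \<le> g v" "(LINT v|M. g v) = 0"
    and A: "A \<in> sets M" "\<And>v. v \<in> A \<Longrightarrow> 0 < g v"
  shows "measure M A = 0"
proof -
  have "AE v in M. g v = 0"
    using assms integral_nonneg_eq_0_iff_AE[OF assms(1)] by auto
  then have "AE v in M. v \<notin> A" using A(2) by (elim eventually_mono) (metis less_irrefl)
  then have "A \<in> null_sets M"
    using A(1) by (simp add: AE_iff_null_sets)
  then show ?thesis by (simp add: measure_eq_0_null_sets)
qed

text \<open>The constant 1 integrates to the total mass. For \<open>\<bar>f\<bar> \<le> 1\<close> on
  the sphere both integrals on the right are nonnegative, which makes this the gap in weak
  duality.\<close>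

lemma sphere_integral_deficit:
  assumes f: "continuous_on (sphere 0 1) f"
  shows "measure (pos_part \<mu>) (sphere 0 1) + measure (pos_part (- \<mu>)) (sphere 0 1) - sphere_integral \<mu> f
    = (LINT v|pos_part \<mu>. 1 - f v) + (LINT v|pos_part (- \<mu>). 1 + f v)"
proof -
  interpret P: finite_measure "pos_part \<mu>" by (rule finite_measure_pos_part)
  interpret Q: finite_measure "pos_part (- \<mu>)" by (rule finite_measure_pos_part)
  show ?thesis
    by (simp add: sphere_integral_def integrable_pos_part[OF f])
qed

lemma sphere_integral_le_tv_norm:
  assumes f: "continuous_on (sphere 0 1) f" and le: "\<And>v. v \<in> sphere 0 1 \<Longrightarrow> \<bar>f v\<bar> \<le> 1"
  shows "sphere_integral \<mu> f \<le> tv_norm \<mu>"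
proof -
  have "0 \<le> (LINT v|pos_part \<mu>. 1 - f v)" "0 \<le> (LINT v|pos_part (- \<mu>). 1 + f v)"
    using le by (auto intro!: Bochner_Integration.integral_nonneg simp: abs_le_iff) force+
  then show ?thesis
    using sphere_integral_deficit[OF f, of \<mu>] tv_norm_ge[of \<mu>] by linarith
qed

text \<open>With \<open>tv_norm_ge\<close>, the assumption \<open>tv\<close> closes the gap of
  \<open>sphere_integral_deficit\<close>, so both of its integrals are 0. Off \<open>W\<close> the
  integrands are strictly positive, hence both parts vanish there.\<close>

lemma concentrated_on_if_tv_norm_le:
  fixes f :: "'a::euclidean_space \<Rightarrow> real"
  assumes f: "continuous_on (sphere 0 1) f" and le: "\<And>v. v \<in> sphere 0 1 \<Longrightarrow> \<bar>f v\<bar> \<le> 1"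
    and less: "\<And>v. v \<in> sphere 0 1 - W \<Longrightarrow> \<bar>f v\<bar> < 1"
    and tv: "tv_norm \<mu> \<le> sphere_integral \<mu> f"
  shows "concentrated_on W \<mu>"
  unfolding concentrated_on_def
proof (intro ballI impI)
  fix B :: "'a set" assume B: "B \<in> sphere_borel" "B \<inter> W = {}"
  have B': "v \<in> sphere 0 1 - W" if "v \<in> B" for v
    using B that sphere_borel.sets_into_space by blast
  have lower: "-1 \<le> f v" "f v \<le> 1" if "v \<in> sphere 0 1" for v using le[OF that] by linarith+
  have strict: "-1 < f v" "f v < 1" if "v \<in> B" for v using less[OF B'[OF that]] by linarith+
  have nn: "0 \<le> (LINT v|pos_part \<mu>. 1 - f v)" "0 \<le> (LINT v|pos_part (- \<mu>). 1 + f v)"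
    using lower by (auto intro!: Bochner_Integration.integral_nonneg) force+
  then have zero: "(LINT v|pos_part \<mu>. 1 - f v) = 0" "(LINT v|pos_part (- \<mu>). 1 + f v) = 0"
    using sphere_integral_deficit[OF f, of \<mu>] tv_norm_ge[of \<mu>] tv by linarith+
  have "measure (pos_part \<mu>) B = 0"
    using zero(1) lower strict B(1)
    by (intro measure_eq_0_if_integral_eq_0[where g = "\<lambda>v. 1 - f v"] integrable_pos_part continuous_intros f) auto
  moreover have "measure (pos_part (- \<mu>)) B = 0"
    using zero(2) lower strict B(1)
    by (intro measure_eq_0_if_integral_eq_0[where g = "\<lambda>v. 1 + f v"] integrable_pos_part continuous_intros f) force+
  ultimately show "mass \<mu> B = 0" by (simp add: mass_eq_pos_part_diff[OF B(1)])
qed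

section \<open>Linear independence and uniqueness\<close>

text \<open>\<open>independent\<close> speaks of a set and does not see repetitions in a family;
  injectivity lets the coefficients be carried over to the vectors by
  \<open>inv_into\<close>.\<close>

lemma sum_scaleR_independent_inj:
  fixes g :: "'a \<Rightarrow> 'b::real_vector"
  assumes "finite W" "inj_on g W" "independent (g ` W)"
    and "(\<Sum>v\<in>W. a v *\<^sub>R g v) = (\<Sum>v\<in>W. b v *\<^sub>R g v)" "v \<in> W"
  shows "a v = b v"
proof -
  let ?u = "\<lambda>z. a (inv_into W g z) - b (inv_into W g z)"
  have "(\<Sum>z\<in>g ` W. ?u z *\<^sub>R z) = (\<Sum>v\<in>W. (a v - b v) *\<^sub>R g v)"
    using assms(2) by (simp add: sum.reindex)
  also have "\<dots> = 0" using assms(4) by (simp add: scaleR_left_diff_distrib sum_subtractf)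
  finally have "?u (g v) = 0"
    using assms independentD[OF assms(3), of "g ` W" ?u "g v"] by auto
  then show ?thesis using assms(2,5) by simp
qed

theorem theorem3p18:
  fixes x :: "'n::finite \<Rightarrow> real ^ 'd"
    and y\<^sub>0 :: "real ^ 'n"
    and \<mu>\<^sub>0 :: "(real ^ 'd) sphere_measure"
    and \<eta>\<^sub>0 :: "real ^ 'd \<Rightarrow> real"
    and N :: nat
    and c \<sigma> :: "nat \<Rightarrow> real"
    and w :: "nat \<Rightarrow> real ^ 'd"
    and \<pi> :: "nat \<Rightarrow> 'n \<Rightarrow> bool"
  assumes "\<And>j. x j \<noteq> 0"
    and "\<mu>\<^sub>0 = (\<Sum>i=1..N. (c i * \<sigma> i) *\<^sub>R dirac (w i))"
    and "y\<^sub>0 = K_op x \<mu>\<^sub>0"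
    and "\<And>i. i \<in> {1..N} \<Longrightarrow> c i > 0"
    and "\<And>i. i \<in> {1..N} \<Longrightarrow> \<sigma> i \<in> {-1, 1}"
    and "\<And>i. i \<in> {1..N} \<Longrightarrow> w i \<in> closure (act_region x (\<pi> i)) \<inter> sphere 0 1"
    and "dual_certificate x \<mu>\<^sub>0 \<eta>\<^sub>0"
    and "inj_on (\<lambda>i. K_op x (dirac (w i))) {1..N}"
    and "independent ((\<lambda>i. K_op x (dirac (w i))) ` {1..N})"
    and "\<And>v. v \<in> sphere 0 1 - w ` {1..N} \<Longrightarrow> \<bar>\<eta>\<^sub>0 v\<bar> < 1"
  shows "solves_P0 x y\<^sub>0 \<mu>\<^sub>0 \<and> (\<forall>\<mu>. solves_P0 x y\<^sub>0 \<mu> \<longrightarrow> \<mu> = \<mu>\<^sub>0)"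
proof -
  let ?W = "w ` {1..N}"
  have W: "finite ?W" "?W \<subseteq> sphere 0 1" using assms(6) by auto
  obtain p where p: "\<And>v. v \<in> sphere 0 1 \<Longrightarrow> \<eta>\<^sub>0 v = K_adj x p v"
    and cont: "continuous_on (sphere 0 1) \<eta>\<^sub>0" and norm: "sphere_sup_norm \<eta>\<^sub>0 \<le> 1"
    and tv0: "sphere_integral \<mu>\<^sub>0 \<eta>\<^sub>0 = tv_norm \<mu>\<^sub>0"
    using assms(7) by (auto simp: dual_certificate_def tv_subdifferential_def)
  \<comment> \<open>The sup norm is a real supremum, so compactness of the sphere is used to make it
    an upper bound.\<close>
  have le: "\<bar>\<eta>\<^sub>0 v\<bar> \<le> 1" if "v \<in> sphere 0 1" for v
  proof -
    have "bdd_above ((\<lambda>v. \<bar>\<eta>\<^sub>0 v\<bar>) ` sphere 0 1)"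
      by (intro bounded_imp_bdd_above compact_imp_bounded compact_continuous_image
          continuous_intros cont compact_sphere)
    then show ?thesis
      using norm cSUP_upper[OF that, of "\<lambda>v. \<bar>\<eta>\<^sub>0 v\<bar>"] by (simp add: sphere_sup_norm_def)
  qed
  have dual: "sphere_integral \<mu> \<eta>\<^sub>0 = tv_norm \<mu>\<^sub>0" if "K_op x \<mu> = y\<^sub>0" for \<mu>
  proof -
    have "sphere_integral \<nu> \<eta>\<^sub>0 = p \<bullet> K_op x \<nu>" for \<nu>
      unfolding sphere_integral_K_adj[symmetric] by (rule sphere_integral_cong[OF p])
    then show ?thesis using that assms(3) tv0 by metis
  qed
  have conc: "concentrated_on ?W \<mu>" if "K_op x \<mu> = y\<^sub>0" "tv_norm \<mu> \<le> tv_norm \<mu>\<^sub>0" for \<mu>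
    using that dual by (intro concentrated_on_if_tv_norm_le[OF cont le assms(10)]) auto
  have min: "tv_norm \<mu>\<^sub>0 \<le> tv_norm \<mu>" if "K_op x \<mu> = y\<^sub>0" for \<mu>
    using sphere_integral_le_tv_norm[OF cont le, of \<mu>] dual[OF that] by simp
  \<comment> \<open>Injectivity passes from the indices to the points, since the proof sums over the
    set of points.\<close>
  have inj: "inj_on (\<lambda>v. K_op x (dirac v)) ?W"
    using assms(8) by (intro inj_on_imageI) (simp add: comp_def)
  have ind: "independent ((\<lambda>v. K_op x (dirac v)) ` ?W)"
    using assms(9) by (simp add: image_image)
  have "\<mu> = \<mu>\<^sub>0" if "solves_P0 x y\<^sub>0 \<mu>" for \<mu>
  proof -
    have K: "K_op x \<mu> = y\<^sub>0" and "\<not> tv_norm \<mu>\<^sub>0 < tv_norm \<mu>"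
      using that assms(3) by (auto simp: solves_P0_def is_arg_min_def)
    then have \<mu>: "concentrated_on ?W \<mu>" by (intro conc) auto
    \<comment> \<open>The equality case applies to \<open>\<mu>\<^sub>0\<close> as well, with the
      norm bound holding trivially.\<close>
    have \<mu>\<^sub>0: "concentrated_on ?W \<mu>\<^sub>0" using assms(3) by (intro conc) auto
    have eq: "(\<Sum>v\<in>?W. mass \<mu> {v} *\<^sub>R K_op x (dirac v)) = (\<Sum>v\<in>?W. mass \<mu>\<^sub>0 {v} *\<^sub>R K_op x (dirac v))"
      unfolding K_op_concentrated[OF W \<mu>, symmetric] K_op_concentrated[OF W \<mu>\<^sub>0, symmetric]
      using K assms(3) by simp
    show ?thesis
    proof (rule concentrated_on_eqI[OF W \<mu> \<mu>\<^sub>0])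
      fix v assume "v \<in> ?W"
      then show "mass \<mu> {v} = mass \<mu>\<^sub>0 {v}"
        by (rule sum_scaleR_independent_inj[OF W(1) inj ind eq])
    qed
  qed
  moreover have "solves_P0 x y\<^sub>0 \<mu>\<^sub>0"
    using min assms(3) by (auto simp: solves_P0_def is_arg_min_def not_less)
  ultimately show ?thesis by blast
qed

end
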